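(* Let $k\ge0$ and $m\ge1$ be integers and let $p(x)\in\mathbb{Q}[x]$ be a nonzero polynomial of degree $d<m+k$. For $n\in\mathbb{Z}$ put $$S_n(m)=\frac1m\sum_{s=1}^{m-1}\frac{p(\xi^s)\,\xi^{ns}}{(1-\xi^s)^k},\qquad \xi=e^{2\pi i/m}.$$ Then $$S_0(m)=p(0)-\frac1m\sum_{\substack{i,j\ge0\\ i+j\le k}}\frac{(-1)^iD^ip(1)}{i!}\,f^{(m)}_j(1).$$ Further, if $p(1/x)=(-1)^{-\delta}x^{-d}p(x)$ for some integer $\delta$, then for every integer $n$ with $1\le n<m+k-d$, $$S_n(m)=-\frac1m\sum_{\substack{i,j\ge0\\ i+j\le k}}(-1)^{k-i-j}\,\frac{(-1)^iD^ip(1)}{i!}\,f^{(m)}_j(1)\binom{n-1}{k-i-j}.$$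
   Context: $D^ip(1)$ is the $i$-th derivative of $p$ evaluated at $1$. For $m\ge1$, $\Psi_m(x)=1+x+\cdots+x^{m-1}$, and $f^{(m)}_j(x)=\big(-\tfrac1m x\Psi_m'(x)\big)^j\ \mathrm{rem}\ \Psi_m(x)$ for $j\ge1$, $f^{(m)}_0(x)=1$, where $f\ \mathrm{rem}\ q$ denotes the remainder of $f$ on Euclidean division by $q$. *)

theory Defs
  imports Complex_Main "HOL-Computational_Algebra.Polynomial"
begin

definition Psi :: "nat \<Rightarrow> rat poly" where
  "Psi m = (\<Sum>i<m. monom 1 i)"

text \<open>The case j = 0 is separate because the remainder of 1 modulo \<^term>\<open>Psi 1 = 1\<close> would be 0.\<close>
definition f_poly :: "nat \<Rightarrow> nat \<Rightarrow> rat poly" where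
  "f_poly m j = (if j = 0 then 1
     else (smult (- 1 / of_nat m) (monom 1 1 * pderiv (Psi m))) ^ j mod Psi m)"

definition D_at_1 :: "nat \<Rightarrow> rat poly \<Rightarrow> rat" where
  "D_at_1 i p = poly ((pderiv ^^ i) p) 1"

definition xi :: "nat \<Rightarrow> complex" where
  "xi m = exp (2 * of_real pi * \<i> / of_nat m)"

definition S :: "rat poly \<Rightarrow> nat \<Rightarrow> int \<Rightarrow> nat \<Rightarrow> complex" where
  "S p k n m = 1 / of_nat m *
     (\<Sum>s=1..m-1. poly (map_poly of_rat p) (xi m ^ s) * xi m powi (n * int s)
                  / (1 - xi m ^ s) ^ k)"

end

theory Submission
  imports Defs
begin

text \<open>Write \<open>\<Psi>\<close> and \<open>f\<^sub>j\<close> for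
  \<^term>\<open>Psi m\<close> and \<^term>\<open>f_poly m j\<close>. Since
  \<open>(1 - x) (-x \<Psi>'(x) / m) = 1\<close> modulo \<open>\<Psi>\<close>, the polynomial
  \<open>f\<^sub>j\<close> interpolates \<open>(1 - x)\<close> to the power \<open>-j\<close> at the nontrivial \<open>m\<close>-th roots of unity, and
  \<open>f\<^sub>j - (1 - x) f\<^bsub>j+1\<^esub> = (f\<^sub>j(1) / m) \<Psi>\<close>. At \<open>x = 0\<close> this gives
  \<open>m f\<^sub>j(0) = m - (f\<^sub>0(1) + \<dots> + f\<^bsub>j-1\<^esub>(1))\<close>. A polynomial \<open>F\<close> of degree less than \<open>m\<close> sums to
  \<open>m F(0) - F(1)\<close> over these roots, so expanding \<open>q\<close> in powers of \<open>1 - x\<close> with coefficients \<open>b\<^sub>i\<close>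
  evaluates the sum of \<open>q(x) / (1 - x)\<^sup>k\<close> over them as
  \<open>m q(0)\<close> minus the sum of \<open>b\<^sub>i f\<^sub>j(1)\<close> over \<open>i + j \<le> k\<close>. The two formulas are the
  cases \<open>q = p\<close> and \<open>q = x\<^sup>n p\<close>.\<close>

section \<open>Transfer of rational polynomials to a field of characteristic 0\<close>

lemma map_poly_of_rat_mult:
  "map_poly of_rat (p * q) = map_poly of_rat p * (map_poly of_rat q :: 'a::field_char_0 poly)"
  by (intro poly_eqI) (simp add: coeff_map_poly coeff_mult of_rat_sum of_rat_mult)

lemma map_poly_of_rat_diff:
  "map_poly of_rat (p - q) = map_poly of_rat p - (map_poly of_rat q :: 'a::field_char_0 poly)"
  by (intro poly_eqI) (simp add: coeff_map_poly of_rat_diff)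

lemma map_poly_of_rat_smult:
  "map_poly of_rat (smult c p) = smult (of_rat c) (map_poly of_rat p :: 'a::field_char_0 poly)"
  by (intro poly_eqI) (simp add: coeff_map_poly of_rat_mult)

lemma map_poly_of_rat_pcompose:
  "map_poly of_rat (p \<circ>\<^sub>p q)
     = map_poly of_rat p \<circ>\<^sub>p (map_poly of_rat q :: 'a::field_char_0 poly)"
proof (induction p)
  case (pCons a p)
  have "map_poly of_rat ([:a:] + q * (p \<circ>\<^sub>p q))
      = [:of_rat a:] + (map_poly of_rat (q * (p \<circ>\<^sub>p q)) :: 'a poly)"
    by (intro poly_eqI) (simp add: coeff_map_poly of_rat_add coeff_pCons split: nat.split)
  then show ?case
    using pCons by (simp add: pcompose_pCons map_poly_pCons map_poly_of_rat_mult)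
qed simp

section \<open>Expansion in powers of \<open>1 - x\<close>\<close>

lemma coeff_one_minus_X_power:
  "coeff ([:1, - 1:] ^ n) i = (- 1) ^ i * (of_nat (n choose i) :: 'a::comm_ring_1)"
proof (induction n arbitrary: i)
  case 0
  then show ?case by (cases i) auto
next
  case (Suc n)
  then show ?case by (cases i) (simp_all add: algebra_simps)
qed

text \<open>Multiplication by \<open>1 - x\<close> takes backward differences of the coefficients,
  so their partial sums telescope.\<close>

lemma sum_coeff_mult_one_minus_X:
  fixes r :: "'a::comm_ring_1 poly"
  shows "(\<Sum>i\<le>N. coeff (r * [:1, - 1:]) i) = coeff r N"
  by (induction N) (simp_all add: coeff_pCons mult.commute[of r])

lemma pcompose_one_minus_X_involution:
  fixes p :: "'a::comm_ring_1 poly"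
  shows "p \<circ>\<^sub>p [:1, - 1:] \<circ>\<^sub>p [:1, - 1:] = p"
proof -
  have "[:1, - 1:] \<circ>\<^sub>p [:1, - 1:] = ([:0, 1:] :: 'a poly)"
    by (simp add: pcompose_pCons)
  then show ?thesis
    by (metis pcompose_assoc pcompose_idR)
qed

lemma higher_pderiv_pcompose_one_minus_X:
  fixes p :: "'a::idom poly"
  shows "(pderiv ^^ i) (p \<circ>\<^sub>p [:1, - 1:])
    = smult ((- 1) ^ i) ((pderiv ^^ i) p \<circ>\<^sub>p [:1, - 1:])"
  by (induction i) (simp_all add: pderiv_smult pderiv_pcompose pderiv_pCons)

text \<open>Taylor expansion of \<open>p\<close> about 1 in the variable \<open>1 - x\<close>, which
  accounts for the signs; these are the weights in both formulas.\<close>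

lemma coeff_pcompose_one_minus_X:
  "coeff (p \<circ>\<^sub>p [:1, - 1:]) i = (- 1) ^ i * D_at_1 i p / fact i"
proof -
  let ?r = "p \<circ>\<^sub>p [:1, - 1:]"
  have "fact i * coeff ?r i = poly ((pderiv ^^ i) ?r) 0"
    by (simp add: coeff_higher_pderiv poly_0_coeff_0 pochhammer_fact)
  also have "\<dots> = (- 1) ^ i * D_at_1 i p"
    by (simp add: higher_pderiv_pcompose_one_minus_X poly_pcompose D_at_1_def)
  finally show ?thesis
    by (simp add: field_simps)
qed

section \<open>Summation over the triangle \<open>i + j \<le> k\<close>\<close>

lemma sum_triangle_eq:
  fixes g :: "nat \<Rightarrow> nat \<Rightarrow> 'a::comm_monoid_add"
  shows "(\<Sum>(i, j) \<in> {(i, j). i + j \<le> k}. g i j) = (\<Sum>i\<le>k. \<Sum>j\<le>k - i. g i j)"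
proof -
  have "{(i, j). i + j \<le> k} = (SIGMA i:{..k}. {..k - i})"
    by auto
  then show ?thesis
    by (simp add: sum.Sigma)
qed

lemma sum_triangle_eq_swap:
  fixes g :: "nat \<Rightarrow> nat \<Rightarrow> 'a::comm_monoid_add"
  shows "(\<Sum>(i, j) \<in> {(i, j). i + j \<le> k}. g i j) = (\<Sum>j\<le>k. \<Sum>i\<le>k - j. g i j)"
proof -
  have "(\<Sum>(i, j) \<in> {(i, j). i + j \<le> k}. g i j) = (\<Sum>(j, i) \<in> {(j, i). j + i \<le> k}. g i j)"
    by (rule sum.reindex_bij_witness[of _ prod.swap prod.swap]) auto
  then show ?thesis
    by (simp add: sum_triangle_eq)
qed

section \<open>The polynomials \<Psi> and their associated remainders\<close>

lemma coeff_Psi: "coeff (Psi m) i = (if i < m then 1 else 0)"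
  by (simp add: Psi_def coeff_sum)

lemma degree_Psi: "m \<ge> 1 \<Longrightarrow> degree (Psi m) = m - 1"
  by (rule antisym) (auto intro!: degree_le le_degree simp: coeff_Psi)

lemma poly_Psi_1: "poly (Psi m) 1 = of_nat m"
  by (simp add: Psi_def poly_sum poly_monom)

lemma poly_Psi_0: "m \<ge> 1 \<Longrightarrow> poly (Psi m) 0 = 1"
  by (simp add: poly_0_coeff_0 coeff_Psi)

lemma X_minus_one_mult_Psi: "[:- 1, 1:] * Psi m = monom 1 m - 1"
  by (intro poly_eqI) (auto simp: coeff_Psi coeff_pCons split: nat.split)

text \<open>Differentiating \<open>(x - 1) \<Psi> = x^m - 1\<close> and multiplying by
  \<open>x\<close> gives \<open>x (x - 1) \<Psi>' = m x^m - x \<Psi>\<close>, which is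
  \<open>m\<close> modulo \<Psi> because \<open>x^m\<close> is 1 there.\<close>

lemma Psi_dvd_inverse_one_minus_X:
  assumes "m \<ge> 1"
  shows "Psi m dvd [:1, - 1:] * smult (- 1 / of_nat m) (monom 1 1 * pderiv (Psi m)) - 1"
proof -
  let ?d = "pderiv (Psi m)" and ?X = "[:0, 1:] :: rat poly"
  have "pderiv ([:- 1, 1:] * Psi m) = pderiv (monom 1 m - 1)"
    by (simp only: X_minus_one_mult_Psi)
  then have "[:- 1, 1:] * ?d + Psi m = monom (of_nat m) (m - 1)"
    by (simp add: pderiv_mult pderiv_diff pderiv_monom pderiv_pCons)
  then have "?X * ([:- 1, 1:] * ?d + Psi m) = ?X * monom (of_nat m) (m - 1)"
    by simp
  also have "\<dots> = smult (of_nat m) (monom 1 m)"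
    using assms by (cases m) (simp_all add: monom_Suc smult_monom)
  also have "monom 1 m = 1 + [:- 1, 1:] * Psi m"
    by (simp only: X_minus_one_mult_Psi add_diff_cancel_left' diff_add_cancel add.commute)
  finally have eq: "?X * [:- 1, 1:] * ?d = smult (of_nat m) (1 + [:- 1, 1:] * Psi m) - ?X * Psi m"
    by (simp only: algebra_simps)
  have A: "[:1, - 1:] = (- [:- 1, 1:] :: rat poly)" and X: "monom 1 1 = ?X"
    by (simp_all add: monom_Suc)
  have "[:1, - 1:] * smult (- 1 / of_nat m) (monom 1 1 * ?d)
      = smult (1 / of_nat m) (?X * [:- 1, 1:] * ?d)"
    by (simp only: X A minus_divide_left[symmetric] smult_minus_left smult_minus_right mult_smult_right
        mult_minus_left mult_minus_right minus_minus mult_ac)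
  also have "\<dots> - 1 = Psi m * ([:- 1, 1:] - smult (1 / of_nat m) ?X)"
    using assms unfolding eq
    by (simp add: smult_diff_right right_diff_distrib mult.commute[of "Psi m"]
        del: mult_pCons_left mult_pCons_right smult_pCons)
  finally show ?thesis
    by (metis dvd_triv_left)
qed

text \<open>A remainder modulo \<open>Psi m\<close> leaves room for one more linear factor. The
  constant 1 at \<open>j = 0\<close> does not when \<open>m = 1\<close>, hence the restriction in
  the second part.\<close>

lemma degree_f_poly_less:
  assumes "m \<ge> 1"
  shows "degree (f_poly m j) < m"
    and "j \<noteq> 0 \<Longrightarrow> degree ([:1, - 1:] * f_poly m j) < m"
proof -
  have nz: "Psi m \<noteq> 0"
    using poly_Psi_0[OF assms] by auto
  \<comment> \<open>For \<open>m = 1\<close> the remainder is 0, and its degree 0 is not below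
    \<open>m - 1\<close>.\<close>
  have lt: "f_poly m j = 0 \<or> degree (f_poly m j) < m - 1" if "j \<noteq> 0"
    using degree_mod_less[OF nz] degree_Psi[OF assms] that by (simp add: f_poly_def)
  show "degree (f_poly m j) < m"
    using lt assms by (cases "j = 0") (auto simp: f_poly_def)
  show "degree ([:1, - 1:] * f_poly m j) < m" if "j \<noteq> 0"
    using lt[OF that] assms degree_mult_le[of "[:1, - 1:]" "f_poly m j"] by auto
qed

text \<open>Both sides agree modulo \<^term>\<open>Psi m\<close>, so they differ by a constant multiple of it;
  evaluation at 1 determines the constant.\<close>
lemma f_poly_rec:
  assumes "m \<ge> 1"
  shows "f_poly m j = [:1, - 1:] * f_poly m (Suc j) + smult (poly (f_poly m j) 1 / of_nat m) (Psi m)"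
proof -
  define g where "g = smult (- 1 / of_nat m) (monom 1 1 * pderiv (Psi m))"
  have f_mod: "Psi m dvd f_poly m i - g ^ i" for i
    by (simp add: f_poly_def g_def mod_eq_dvd_iff[symmetric])
  \<comment> \<open>Each of the three terms is divisible by \<open>Psi m\<close>, and in their
    combination all powers of \<open>g\<close> cancel.\<close>
  have "Psi m dvd (f_poly m j - g ^ j) - [:1, - 1:] * (f_poly m (Suc j) - g ^ Suc j)
      - ([:1, - 1:] * g - 1) * g ^ j"
    by (intro dvd_diff f_mod dvd_mult[OF f_mod]
        dvd_mult2[OF Psi_dvd_inverse_one_minus_X[OF assms, folded g_def]])
  also have "\<dots> = f_poly m j - [:1, - 1:] * f_poly m (Suc j)"
    by (simp only: algebra_simps power_Suc)
  finally obtain h where h: "f_poly m j - [:1, - 1:] * f_poly m (Suc j) = Psi m * h" ..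
  have nz: "Psi m \<noteq> 0"
    using poly_Psi_0[OF assms] by auto
  have "degree (Psi m * h) < m"
    using degree_diff_less[OF degree_f_poly_less(1) degree_f_poly_less(2)] assms
    by (simp flip: h)
  then have "degree h = 0"
    using nz degree_Psi[OF assms] by (cases "h = 0") (auto simp: degree_mult_eq)
  then obtain c where c: "h = [:c:]"
    by (rule degree_eq_zeroE)
  have "poly (f_poly m j) 1 = of_nat m * c"
    using arg_cong[OF h, of "\<lambda>q. poly q 1"] by (simp add: poly_Psi_1 c)
  then have "c = poly (f_poly m j) 1 / of_nat m"
    using assms by simp
  then show ?thesis
    using h by (simp add: c algebra_simps)
qed

lemma poly_f_poly_0:
  assumes "m \<ge> 1"
  shows "of_nat m * poly (f_poly m j) 0 = of_nat m - (\<Sum>l<j. poly (f_poly m l) 1)"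
proof (induction j)
  case 0
  then show ?case by (simp add: f_poly_def)
next
  case (Suc j)
  have "poly (f_poly m j) 0 = poly (f_poly m (Suc j)) 0 + poly (f_poly m j) 1 / of_nat m"
    by (subst f_poly_rec[OF assms]) (simp add: poly_Psi_0[OF assms])
  then have "of_nat m * poly (f_poly m j) 0
      = of_nat m * poly (f_poly m (Suc j)) 0 + poly (f_poly m j) 1"
    using assms by (simp add: distrib_left)
  with Suc show ?case
    by simp
qed

section \<open>Sums over the \<open>m\<close>-th roots of unity\<close>

lemma xi_power_eq_cis: "xi m ^ s = cis (2 * pi * real s / real m)"
proof -
  have "xi m = cis (2 * pi / real m)"
    by (simp add: xi_def cis_conv_exp mult_ac)
  then show ?thesis
    by (simp add: DeMoivre mult_ac)
qed

lemma xi_power_neq_1: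
  assumes "s \<in> {1..m-1}"
  shows "xi m ^ s \<noteq> 1"
proof
  assume "xi m ^ s = 1"
  then have "cis (2 * pi * real s / real m) = cis (2 * pi * real 0 / real m)"
    by (simp add: xi_power_eq_cis)
  then show False
    using inj_onD[OF bij_betw_imp_inj_on[OF bij_betw_roots_unity, of m], of s 0] assms by force
qed

lemma xi_power_self: "m \<ge> 1 \<Longrightarrow> xi m ^ m = 1"
  by (simp add: xi_power_eq_cis)

lemma sum_xi_power:
  assumes "i < m"
  shows "(\<Sum>s<m. (xi m ^ s) ^ i) = (if i = 0 then of_nat m else 0)"
proof (cases "i = 0")
  case False
  have "(\<Sum>s<m. (xi m ^ s) ^ i) = (\<Sum>s<m. (xi m ^ i) ^ s)"
    by (simp flip: power_mult add: mult.commute)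
  also have "\<dots> = ((xi m ^ i) ^ m - 1) / (xi m ^ i - 1)"
    using xi_power_neq_1 False assms by (intro geometric_sum) auto
  also have "(xi m ^ i) ^ m = (xi m ^ m) ^ i"
    by (simp flip: power_mult add: mult.commute)
  finally show ?thesis
    using False assms by (simp add: xi_power_self)
qed simp

text \<open>Only the constant coefficient survives, since the powers with exponent strictly between
  0 and \<open>m\<close> sum to zero.\<close>

lemma sum_poly_xi:
  fixes F :: "complex poly"
  assumes "degree F < m"
  shows "(\<Sum>s<m. poly F (xi m ^ s)) = of_nat m * poly F 0"
proof -
  have "(\<Sum>s<m. poly F (xi m ^ s)) = (\<Sum>s<m. \<Sum>i\<le>degree F. coeff F i * (xi m ^ s) ^ i)"
    by (simp add: poly_altdef)
  also have "\<dots> = (\<Sum>i\<le>degree F. coeff F i * (\<Sum>s<m. (xi m ^ s) ^ i))"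
    by (subst sum.swap) (simp add: sum_distrib_left)
  also have "\<dots> = (\<Sum>i\<le>degree F. if i = 0 then of_nat m * coeff F 0 else 0)"
    using assms by (intro sum.cong) (auto simp: sum_xi_power)
  finally show ?thesis
    by (simp add: poly_0_coeff_0)
qed

lemma sum_poly_xi_nontrivial:
  fixes q :: "rat poly"
  assumes "degree q < m"
  shows "(\<Sum>s=1..m-1. poly (map_poly of_rat q) (xi m ^ s))
    = of_rat (of_nat m * poly q 0 - poly q 1)"
proof -
  have ev: "poly (map_poly of_rat q) (of_rat x) = (of_rat (poly q x) :: complex)" for x
    by (simp add: poly_altdef coeff_map_poly of_rat_sum of_rat_mult of_rat_power degree_map_poly)
  have "{..<m} = insert 0 {1..m-1}"
    using assms by auto
  then have "(\<Sum>s<m. poly (map_poly of_rat q) (xi m ^ s))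
      = poly (map_poly of_rat q) 1 + (\<Sum>s=1..m-1. poly (map_poly of_rat q) (xi m ^ s))"
    by simp
  moreover have "(\<Sum>s<m. poly (map_poly of_rat q) (xi m ^ s)) = of_nat m * poly (map_poly of_rat q) 0"
    using assms by (intro sum_poly_xi) (simp add: degree_map_poly)
  ultimately show ?thesis
    using ev[of 0] ev[of 1] by (simp add: of_rat_diff of_rat_mult)
qed

text \<open>\<Psi> vanishes at \<open>xi m ^ s\<close>, so there \<open>f_poly_rec\<close> says that
  each step in \<open>j\<close> divides the value by \<open>1 - xi m ^ s\<close>.\<close>

lemma poly_f_poly_xi:
  assumes "s \<in> {1..m-1}"
  shows "poly (map_poly of_rat (f_poly m j)) (xi m ^ s) * (1 - xi m ^ s) ^ j = 1"
proof (induction j)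
  case 0
  then show ?case by (simp add: f_poly_def)
next
  case (Suc j)
  have m: "m \<ge> 1" and neq: "xi m ^ s \<noteq> 1"
    using assms xi_power_neq_1 by auto
  \<comment> \<open>The factor \<open>x - 1\<close> of \<open>x^m - 1\<close> is nonzero at
    \<open>xi m ^ s\<close>, so \<Psi> must vanish there.\<close>
  have "poly (map_poly of_rat ([:- 1, 1:] * Psi m)) (xi m ^ s) = (xi m ^ s) ^ m - 1"
    by (simp only: X_minus_one_mult_Psi map_poly_of_rat_diff map_poly_monom)
       (simp add: map_poly_monom poly_monom)
  also have "(xi m ^ s) ^ m = (xi m ^ m) ^ s"
    by (simp flip: power_mult add: mult.commute)
  finally have Psi0: "poly (map_poly of_rat (Psi m)) (xi m ^ s) = 0"
    using neq m by (simp add: map_poly_of_rat_mult map_poly_pCons xi_power_self del: mult_pCons_left)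
  have "f_poly m j - [:1, - 1:] * f_poly m (Suc j) = smult (poly (f_poly m j) 1 / of_nat m) (Psi m)"
    using f_poly_rec[OF m, of j] by (simp add: algebra_simps)
  from arg_cong[OF this, of "\<lambda>q. poly (map_poly of_rat q) (xi m ^ s)"]
  have "poly (map_poly of_rat (f_poly m j)) (xi m ^ s)
      = (1 - xi m ^ s) * poly (map_poly of_rat (f_poly m (Suc j))) (xi m ^ s)"
    by (simp add: map_poly_of_rat_diff map_poly_of_rat_mult map_poly_of_rat_smult map_poly_pCons Psi0
        left_diff_distrib del: mult_pCons_left)
  with Suc show ?case
    by (simp add: algebra_simps)
qed

text \<open>For \<open>i \<le> k\<close> the summand is interpolated by
  \<open>f_poly m (k - i)\<close>; for \<open>i > k\<close> it is itself a polynomial of degree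
  below \<open>m\<close>, with value 1 at 0 and 0 at 1.\<close>

lemma sum_one_minus_xi_power:
  assumes "m \<ge> 1" and "i < m + k"
  shows "(\<Sum>s=1..m-1. (1 - xi m ^ s) ^ i / (1 - xi m ^ s) ^ k)
    = of_rat (of_nat m - (if i \<le> k then \<Sum>l\<le>k - i. poly (f_poly m l) 1 else 0))"
proof (cases "i \<le> k")
  case True
  have "(1 - xi m ^ s) ^ i / (1 - xi m ^ s) ^ k = poly (map_poly of_rat (f_poly m (k - i))) (xi m ^ s)"
    if "s \<in> {1..m-1}" for s
  proof -
    have "xi m ^ s \<noteq> 1"
      using that by (rule xi_power_neq_1)
    moreover have "(1 - xi m ^ s) ^ k = (1 - xi m ^ s) ^ i * (1 - xi m ^ s) ^ (k - i)"
      using True by (simp flip: power_add)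
    ultimately show ?thesis
      using poly_f_poly_xi[OF that, of "k - i"] by (simp add: field_simps)
  qed
  then have "(\<Sum>s=1..m-1. (1 - xi m ^ s) ^ i / (1 - xi m ^ s) ^ k)
      = of_rat (of_nat m * poly (f_poly m (k - i)) 0 - poly (f_poly m (k - i)) 1)"
    by (subst sum_poly_xi_nontrivial[symmetric]) (use degree_f_poly_less(1)[OF assms(1)] in auto)
  \<comment> \<open>The value at 0 supplies the terms \<open>l < k - i\<close>, the value at 1 the
    last term \<open>l = k - i\<close>.\<close>
  then show ?thesis
    using True by (simp add: poly_f_poly_0[OF assms(1)] lessThan_Suc_atMost[symmetric])
next
  case False
  define q :: "rat poly" where "q = [:1, - 1:] ^ (i - k)"
  have "(1 - xi m ^ s) ^ i / (1 - xi m ^ s) ^ k = poly (map_poly of_rat q) (xi m ^ s)"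
    if "s \<in> {1..m-1}" for s
  proof -
    have "map_poly of_rat ([:1, - 1:] ^ n) = ([:1, - 1:] ^ n :: complex poly)" for n
      by (induction n) (simp_all add: map_poly_of_rat_mult map_poly_pCons del: mult_pCons_left)
    moreover have "xi m ^ s \<noteq> 1"
      using that by (rule xi_power_neq_1)
    moreover have "(1 - xi m ^ s) ^ i = (1 - xi m ^ s) ^ (i - k) * (1 - xi m ^ s) ^ k"
      using False by (simp flip: power_add)
    ultimately show ?thesis
      by (simp add: q_def)
  qed
  moreover have "degree q < m"
    using False assms degree_power_le[of "[:1, - 1:] :: rat poly" "i - k"] by (simp add: q_def)
  ultimately have "(\<Sum>s=1..m-1. (1 - xi m ^ s) ^ i / (1 - xi m ^ s) ^ k)
      = of_rat (of_nat m * poly q 0 - poly q 1)"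
    by (subst sum_poly_xi_nontrivial[symmetric]) auto
  then show ?thesis
    using False by (simp add: q_def power_0_left)
qed

lemma sum_poly_div_one_minus_xi:
  fixes q :: "rat poly"
  assumes "m \<ge> 1" and "degree q < m + k"
  shows "(\<Sum>s=1..m-1. poly (map_poly of_rat q) (xi m ^ s) / (1 - xi m ^ s) ^ k)
    = of_rat (of_nat m * poly q 0
        - (\<Sum>i\<le>k. coeff (q \<circ>\<^sub>p [:1, - 1:]) i * (\<Sum>l\<le>k - i. poly (f_poly m l) 1)))"
proof -
  define r where "r = q \<circ>\<^sub>p [:1, - 1:]"
  define C where "C = (\<lambda>i. \<Sum>l\<le>k - i. poly (f_poly m l) 1)"
  have q: "q = r \<circ>\<^sub>p [:1, - 1:]"
    by (simp add: r_def pcompose_one_minus_X_involution)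
  have deg: "degree r < m + k"
    using assms by (simp add: r_def degree_pcompose)
  \<comment> \<open>Padding with zero coefficients up to \<open>m + k\<close> gives a range on which
    \<open>sum_one_minus_xi_power\<close> applies to every term.\<close>
  have alt: "poly (map_poly of_rat r) y = (\<Sum>i<m+k. of_rat (coeff r i) * y ^ i)" for y :: complex
  proof -
    have "poly (map_poly of_rat r) y = (\<Sum>i\<le>degree r. of_rat (coeff r i) * y ^ i)"
      by (simp add: poly_altdef coeff_map_poly degree_map_poly)
    also have "\<dots> = (\<Sum>i<m+k. of_rat (coeff r i) * y ^ i)"
      using deg by (intro sum.mono_neutral_left) (auto simp: coeff_eq_0)
    finally show ?thesis .
  qed
  have "poly q 0 = poly r 1"
    by (simp add: q poly_pcompose)
  also have "\<dots> = (\<Sum>i\<le>degree r. coeff r i)"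
    by (simp add: poly_altdef)
  also have "\<dots> = (\<Sum>i<m+k. coeff r i)"
    using deg by (intro sum.mono_neutral_left) (auto simp: coeff_eq_0)
  finally have q0: "poly q 0 = (\<Sum>i<m+k. coeff r i)" .
  have "(\<Sum>s=1..m-1. poly (map_poly of_rat q) (xi m ^ s) / (1 - xi m ^ s) ^ k)
      = (\<Sum>s=1..m-1. \<Sum>i<m+k. of_rat (coeff r i) * ((1 - xi m ^ s) ^ i / (1 - xi m ^ s) ^ k))"
    by (simp add: q map_poly_of_rat_pcompose map_poly_pCons poly_pcompose alt sum_divide_distrib)
  also have "\<dots> = (\<Sum>i<m+k. of_rat (coeff r i)
      * (\<Sum>s=1..m-1. (1 - xi m ^ s) ^ i / (1 - xi m ^ s) ^ k))"
    by (subst sum.swap) (simp add: sum_distrib_left)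
  also have "\<dots> = of_rat (\<Sum>i<m+k. coeff r i * (of_nat m - (if i \<le> k then C i else 0)))"
    unfolding of_rat_sum of_rat_mult
    by (intro sum.cong refl arg_cong2[of _ _ _ _ "(*)"])
       (subst sum_one_minus_xi_power[OF assms(1)], auto simp: C_def)
  also have "(\<Sum>i<m+k. coeff r i * (of_nat m - (if i \<le> k then C i else 0)))
      = of_nat m * poly q 0 - (\<Sum>i<m+k. if i \<le> k then coeff r i * C i else 0)"
    unfolding q0 sum_distrib_left sum_subtractf[symmetric]
    by (intro sum.cong) (auto simp: algebra_simps)
  \<comment> \<open>Here \<open>m \<ge> 1\<close> ensures that the index \<open>k\<close> lies in
    the range below \<open>m + k\<close>.\<close>
  also have "(\<Sum>i<m+k. if i \<le> k then coeff r i * C i else 0) = (\<Sum>i\<le>k. coeff r i * C i)"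
    using assms(1) by (intro sum.mono_neutral_cong_right) auto
  finally show ?thesis
    by (simp add: r_def C_def)
qed

section \<open>The formulas for \<open>S\<close>\<close>

lemma S_nonneg_eq:
  assumes "m \<ge> 1" and "degree (p * monom 1 n) < m + k"
  shows "S p k (int n) m = of_rat (poly (p * monom 1 n) 0 - 1 / of_nat m *
    (\<Sum>i\<le>k. coeff ((p * monom 1 n) \<circ>\<^sub>p [:1, - 1:]) i * (\<Sum>l\<le>k - i. poly (f_poly m l) 1)))"
proof -
  have "S p k (int n) m = 1 / of_nat m *
      (\<Sum>s=1..m-1. poly (map_poly of_rat (p * monom 1 n)) (xi m ^ s) / (1 - xi m ^ s) ^ k)"
    unfolding S_def
    by (intro sum.cong refl arg_cong2[of _ _ _ _ "(*)"])
       (simp flip: of_nat_mult power_mult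
          add: power_int_of_nat map_poly_of_rat_mult map_poly_monom poly_monom mult.commute)
  also have "\<dots> = of_rat (1 / of_nat m * (of_nat m * poly (p * monom 1 n) 0 -
    (\<Sum>i\<le>k. coeff ((p * monom 1 n) \<circ>\<^sub>p [:1, - 1:]) i * (\<Sum>l\<le>k - i. poly (f_poly m l) 1))))"
    by (subst sum_poly_div_one_minus_xi[OF assms]) (simp only: of_rat_mult of_rat_divide of_rat_1 of_rat_of_nat_eq)
  finally show ?thesis
    using assms(1) by (simp add: right_diff_distrib)
qed

text \<open>Multiplying by \<open>x\<^sup>n\<close> multiplies the expansion in \<open>t = 1 - x\<close> by \<open>(1 - t)\<^sup>n\<close>; taking partial
  sums of coefficients divides it by \<open>1 - t\<close>, which leaves \<open>(1 - t)\<^sup>n\<^sup>-\<^sup>1\<close>.\<close>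
lemma sum_coeff_monom_mult_pcompose_one_minus_X:
  "(\<Sum>i\<le>N. coeff ((p * monom 1 (Suc n)) \<circ>\<^sub>p [:1, - 1:]) i)
    = (\<Sum>i\<le>N. (- 1) ^ (N - i) * ((- 1) ^ i * D_at_1 i p / fact i) * of_nat (n choose (N - i)))"
proof -
  have "monom 1 l \<circ>\<^sub>p [:1, - 1:] = ([:1, - 1:] ^ l :: rat poly)" for l
    by (induction l) (simp_all add: monom_Suc pcompose_pCons pcompose_1 del: mult_pCons_left)
  then have "(p * monom 1 (Suc n)) \<circ>\<^sub>p [:1, - 1:]
      = (p \<circ>\<^sub>p [:1, - 1:] * [:1, - 1:] ^ n) * [:1, - 1:]"
    by (simp only: pcompose_mult power_Suc mult_ac)
  then show ?thesis
    unfolding coeff_pcompose_one_minus_X[symmetric]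
    by (simp only: sum_coeff_mult_one_minus_X)
       (simp add: coeff_mult[of "p \<circ>\<^sub>p _"] coeff_one_minus_X_power mult_ac)
qed

theorem theorem6p5:
  fixes k m :: nat and p :: "rat poly"
  assumes "m \<ge> 1" and "p \<noteq> 0" and "degree p < m + k"
  shows "S p k 0 m = of_rat (poly p 0 - 1 / of_nat m *
           (\<Sum>(i, j) \<in> {(i, j). i + j \<le> k}.
              (-1) ^ i * D_at_1 i p / fact i * poly (f_poly m j) 1))
       \<and> (\<forall>\<delta>::int.
           (\<forall>x::rat. x \<noteq> 0 \<longrightarrow>
              poly p (1 / x) = (-1) powi (- \<delta>) * x powi (- int (degree p)) * poly p x) \<longrightarrow>
           (\<forall>n::int. 1 \<le> n \<and> n < int m + int k - int (degree p) \<longrightarrow>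
              S p k n m = of_rat (- (1 / of_nat m) *
                (\<Sum>(i, j) \<in> {(i, j). i + j \<le> k}.
                   (-1) ^ (k - i - j) * ((-1) ^ i * D_at_1 i p / fact i) * poly (f_poly m j) 1
                     * of_nat (nat (n - 1) choose (k - i - j))))))"
proof (intro conjI allI impI)
  show "S p k 0 m = of_rat (poly p 0 - 1 / of_nat m *
      (\<Sum>(i, j) \<in> {(i, j). i + j \<le> k}.
         (- 1) ^ i * D_at_1 i p / fact i * poly (f_poly m j) 1))"
    using S_nonneg_eq[of m p 0 k] assms
    by (simp add: sum_triangle_eq sum_distrib_left coeff_pcompose_one_minus_X)
next
  fix n :: int
  assume n: "1 \<le> n \<and> n < int m + int k - int (degree p)"
  \<comment> \<open>One factor \<open>x\<close> of \<open>x^n\<close> is set aside to cancel against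
    the partial summation; the other \<open>N\<close> factors produce the binomial
    coefficients.\<close>
  define N where "N = nat (n - 1)"
  have n_eq: "n = int (Suc N)"
    using n by (simp add: N_def)
  let ?q = "p * monom 1 (Suc N)"
  let ?g = "\<lambda>i j. (- 1) ^ (k - i - j) * ((- 1) ^ i * D_at_1 i p / fact i) * poly (f_poly m j) 1
     * of_nat (N choose (k - i - j))"
  \<comment> \<open>The upper bound on \<open>n\<close> is precisely this degree condition.\<close>
  have "degree ?q < m + k"
    using n degree_mult_le[of p "monom 1 (Suc N)"] by (simp add: n_eq degree_monom_eq)
  moreover have "poly ?q 0 = 0"
    by (simp add: poly_monom)
  ultimately have "S p k n m = of_rat (- (1 / of_nat m) *
      (\<Sum>i\<le>k. coeff (?q \<circ>\<^sub>p [:1, - 1:]) i * (\<Sum>j\<le>k - i. poly (f_poly m j) 1)))"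
    unfolding n_eq using assms(1) by (subst S_nonneg_eq) simp_all
  also have "(\<Sum>i\<le>k. coeff (?q \<circ>\<^sub>p [:1, - 1:]) i * (\<Sum>j\<le>k - i. poly (f_poly m j) 1))
      = (\<Sum>(i, j) \<in> {(i, j). i + j \<le> k}. coeff (?q \<circ>\<^sub>p [:1, - 1:]) i * poly (f_poly m j) 1)"
    by (simp only: sum_triangle_eq sum_distrib_left)
  \<comment> \<open>With \<open>j\<close> outermost, the inner sum is a partial sum of the
    coefficients of \<open>?q\<close> in powers of \<open>1 - x\<close>, which has a closed
    form.\<close>
  also have "\<dots> = (\<Sum>j\<le>k. (\<Sum>i\<le>k - j. coeff (?q \<circ>\<^sub>p [:1, - 1:]) i) * poly (f_poly m j) 1)"
    by (simp only: sum_triangle_eq_swap sum_distrib_right)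
  also have "\<dots> = (\<Sum>j\<le>k. \<Sum>i\<le>k - j. ?g i j)"
    by (simp only: sum_coeff_monom_mult_pcompose_one_minus_X sum_distrib_right)
       (simp add: add.commute mult_ac)
  also have "\<dots> = (\<Sum>(i, j) \<in> {(i, j). i + j \<le> k}. ?g i j)"
    by (simp only: sum_triangle_eq_swap)
  finally show "S p k n m = of_rat (- (1 / of_nat m) *
      (\<Sum>(i, j) \<in> {(i, j). i + j \<le> k}.
         (- 1) ^ (k - i - j) * ((- 1) ^ i * D_at_1 i p / fact i) * poly (f_poly m j) 1
           * of_nat (nat (n - 1) choose (k - i - j))))"
    by (simp only: N_def)
qed

end
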